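(* Let $q$ be a complex number with $|q|<1$. For $k=1,2,\dots,8$ define \[ Y_k(q):=q^{k}\,\frac{(q^{17-2k},q^{51+2k};q^{68})_\infty}{(q^{17+2k},q^{51-2k};q^{68})_\infty} = q^{k}\,\frac{f(-q^{17-2k},-q^{51+2k})}{f(-q^{17+2k},-q^{51-2k})}. \] (So $Y_1(q)=q f(-q^{15},-q^{53})/f(-q^{19},-q^{49})$, \dots, $Y_8(q)=q^{8}f(-q,-q^{67})/f(-q^{33},-q^{35})$.) Then for each $k=1,\dots,8$, \[ \frac{1}{Y_k(q)}+Y_k(q)=\frac{\phi(-q^{17})\,f(q^{2k},q^{34-2k})}{q^{k}\,\psi(q^{34})\,f(-q^{17-2k},-q^{17+2k})}, \qquad \frac{1}{Y_k(q)}-Y_k(q)=\frac{\phi(q^{17})\,f(-q^{2k},-q^{34-2k})}{q^{k}\,\psi(q^{34})\,f(-q^{17-2k},-q^{17+2k})}. \]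
   Context: For complex $\lambda$ and $|q|<1$, $(\lambda;q)_\infty=\prod_{n\ge0}(1-\lambda q^n)$ and $(\lambda_1,\dots,\lambda_l;q)_\infty=\prod_{i}(\lambda_i;q)_\infty$. Ramanujan's general theta function is $f(a,b)=\sum_{n=-\infty}^{\infty}a^{n(n+1)/2}b^{n(n-1)/2}$ for $|ab|<1$, with $\phi(q)=f(q,q)=\sum_{n}q^{n^2}$ and $\psi(q)=f(q,q^3)=\sum_{n\ge0}q^{n(n+1)/2}$. *)

theory Defs
  imports "HOL-Analysis.Analysis"
begin

definition qpoch_inf :: "complex \<Rightarrow> complex \<Rightarrow> complex" where
  "qpoch_inf a q = (\<Prod>n. 1 - a * q ^ n)"

definition qpochs_inf :: "complex list \<Rightarrow> complex \<Rightarrow> complex" where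
  "qpochs_inf as q = (\<Prod>a\<leftarrow>as. qpoch_inf a q)"

(* Both exponents are nonnegative integers, so no negative powers occur. *)
definition ramanujan_f :: "complex \<Rightarrow> complex \<Rightarrow> complex" where
  "ramanujan_f a b =
     (\<Sum>\<^sub>\<infinity>n\<in>(UNIV :: int set). a powi (n * (n + 1) div 2) * b powi (n * (n - 1) div 2))"

definition ramanujan_phi :: "complex \<Rightarrow> complex" where
  "ramanujan_phi q = ramanujan_f q q"

definition ramanujan_psi :: "complex \<Rightarrow> complex" where
  "ramanujan_psi q = ramanujan_f q (q ^ 3)"

(* Intended for k = 1, ..., 8, where the truncated subtractions are exact. *)
definition Y :: "nat \<Rightarrow> complex \<Rightarrow> complex" where
  "Y k q = q ^ k *
     (qpochs_inf [q ^ (17 - 2 * k), q ^ (51 + 2 * k)] (q ^ 68) /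
      qpochs_inf [q ^ (17 + 2 * k), q ^ (51 - 2 * k)] (q ^ 68))"

end

theory Submission
  imports Defs
begin

text \<open>
  Put \<open>p = q\<^sup>1\<^sup>7\<close>, \<open>z = q\<^sup>2\<^sup>k\<close> and \<open>\<theta>(z, w) = \<Sum>\<^sub>n z\<^sup>n w\<^bsup>n\<^sup>2\<^esup>\<close>, so that \<open>f(zw, w/z) = \<theta>(z, w)\<close>. By
  the Jacobi triple product, \<open>Y\<^sub>k = q\<^sup>k A / B\<close> with \<open>A = \<theta>(-pz, p\<^sup>2)\<close> and \<open>B = \<theta>(-z/p, p\<^sup>2)\<close>, hence
  \<open>1/Y\<^sub>k \<plusminus> Y\<^sub>k = (B\<^sup>2 \<plusminus> z A\<^sup>2) / (q\<^sup>k A B)\<close>. Substituting \<open>(m, n) = (r + s, r - s)\<close> or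
  \<open>(r + s + 1, r - s)\<close> according to the parity of \<open>m + n\<close> in the double series of
  \<open>\<theta>(u, w) \<theta>(v, w)\<close> rewrites this product through thetas of base \<open>w\<^sup>2\<close>. The choices \<open>v = \<plusminus>1\<close> yield
  the factorisations of \<open>B\<^sup>2 \<plusminus> z A\<^sup>2\<close>, and expanding \<open>A B\<close> itself in the same way gives
  \<open>A B = \<psi>(p\<^sup>2) f(-p/z, -pz)\<close>.
\<close>

section \<open>Theta series in the parameters z and w: convergence and symmetry\<close>

definition theta :: "complex \<Rightarrow> complex \<Rightarrow> complex" where
  "theta z w = (\<Sum>\<^sub>\<infinity>n\<in>(UNIV :: int set). z powi n * w powi (n\<^sup>2))"

text \<open>The term is \<open>(c * x ^ n) ^ n\<close>, and \<open>c * x ^ n\<close> tends to 0, so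
  a geometric series of ratio 1/2 eventually dominates, however large \<open>c\<close> is.\<close>

lemma summable_theta_nat:
  fixes c x :: real
  assumes "c \<ge> 0" "0 \<le> x" "x < 1"
  shows "summable (\<lambda>n. c ^ n * x ^ (n\<^sup>2))"
proof -
  have "(\<lambda>n. c * x ^ n) \<longlonglongrightarrow> c * 0"
    by (intro tendsto_mult tendsto_const LIMSEQ_realpow_zero assms)
  hence "\<forall>\<^sub>F n in sequentially. c * x ^ n < 1 / 2"
    by (rule order_tendstoD) auto
  hence "\<forall>\<^sub>F n in sequentially. norm (c ^ n * x ^ (n\<^sup>2)) \<le> (1 / 2) ^ n"
  proof eventually_elim
    case (elim n)
    have "c ^ n * x ^ (n\<^sup>2) = (c * x ^ n) ^ n"
      by (simp add: power_mult_distrib power2_eq_square flip: power_mult)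
    also have "\<dots> \<le> (1 / 2) ^ n"
      using elim assms by (intro power_mono) auto
    finally show ?case using assms by simp
  qed
  thus ?thesis
    by (rule summable_comparison_test_ev) (auto intro: summable_geometric)
qed

text \<open>The nonnegative and the nonpositive indices each give a one-sided series, with
  \<open>c\<close> equal to the norm of \<open>z\<close> and of \<open>inverse z\<close>
  respectively.\<close>

lemma theta_abs_summable:
  fixes z w :: complex
  assumes "norm w < 1"
  shows "(\<lambda>n::int. norm (z powi n * w powi (n\<^sup>2))) summable_on UNIV"
proof -
  let ?f = "\<lambda>n::int. norm (z powi n * w powi (n\<^sup>2))"
  have *: "(\<lambda>n::nat. c ^ n * norm w ^ (n\<^sup>2)) summable_on UNIV" if "c \<ge> 0" for c
    using summable_theta_nat[OF that _ assms] that
    by (intro norm_summable_imp_summable_on) (simp add: norm_mult norm_power abs_mult)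
  have pow: "w powi ((int n)\<^sup>2) = w ^ (n\<^sup>2)" for n
    by (metis of_nat_power power_int_of_nat)
  have "?f summable_on range int"
    using *[of "norm z"]
    by (subst summable_on_reindex) (auto simp: o_def norm_mult norm_power pow)
  moreover have "?f summable_on range (\<lambda>n. - int n)"
    using *[of "norm (inverse z)"]
    by (subst summable_on_reindex)
       (auto simp: o_def norm_mult norm_power norm_inverse power_int_minus pow inj_on_def
         simp flip: power_inverse)
  \<comment> \<open>Index 0 lies in both halves; removing \<open>range int\<close> leaves the
    negative integers and makes the union disjoint.\<close>
  hence "?f summable_on (range (\<lambda>n. - int n) - range int)"
    by (rule summable_on_subset_banach) auto
  ultimately have "?f summable_on (range int \<union> (range (\<lambda>n. - int n) - range int))"
    by (rule summable_on_Un_disjoint) auto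
  also have "range int \<union> (range (\<lambda>n. - int n) - range int) = UNIV"
  proof -
    have "m \<in> range int \<or> m \<in> range (\<lambda>n. - int n)" for m
      by (cases m rule: int_cases2) auto
    thus ?thesis by blast
  qed
  finally show ?thesis .
qed

lemma theta_has_sum:
  assumes "norm w < 1"
  shows "((\<lambda>n. z powi n * w powi (n\<^sup>2)) has_sum theta z w) UNIV"
  unfolding theta_def
  by (rule has_sum_infsum[OF abs_summable_summable[OF theta_abs_summable[OF assms]]])

text \<open>The two triangular exponents have difference n and sum n^2, so z collects the power n
  and w the power n^2.\<close>

lemma ramanujan_f_eq_theta:
  assumes "z \<noteq> 0" "w \<noteq> 0"
  shows "ramanujan_f (z * w) (w / z) = theta z w"
  unfolding ramanujan_f_def theta_def
proof (rule infsum_cong)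
  fix n :: int
  define i j where "i = n * (n + 1) div 2" and "j = n * (n - 1) div 2"
  have "2 * i = n * (n + 1)" "2 * j = n * (n - 1)"
    by (simp_all add: i_def j_def)
  hence ij: "i - j = n" "i + j = n\<^sup>2"
    by (simp_all add: algebra_simps power2_eq_square)
  have "(z * w) powi i * (w / z) powi j = z powi (i - j) * w powi (i + j)"
    using assms by (simp add: power_int_mult_distrib power_int_divide_distrib power_int_add power_int_diff)
  thus "(z * w) powi (n * (n + 1) div 2) * (w / z) powi (n * (n - 1) div 2)
      = z powi n * w powi (n\<^sup>2)"
    unfolding ij unfolding i_def j_def .
qed

lemma theta_inverse: "theta (inverse z) w = theta z w"
proof -
  have "inverse z powi n = z powi - n" for n
    by (metis power_int_inverse power_int_minus)
  thus ?thesis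
    unfolding theta_def
    by (intro infsum_reindex_bij_witness[of _ uminus uminus]) simp_all
qed

section \<open>Products and dissections of theta series\<close>

lemma has_sum_mult_Times:
  fixes f g :: "_ \<Rightarrow> complex"
  assumes "(f has_sum a) A" "(g has_sum b) B" "(\<lambda>x. norm (f x)) summable_on A" "(\<lambda>y. norm (g y)) summable_on B"
  shows "((\<lambda>(x, y). f x * g y) has_sum (a * b)) (A \<times> B)"
proof -
  have *: "(\<lambda>p. norm (f (fst p) * g (snd p))) summable_on A \<times> B"
    unfolding Infinite_Sum.abs_summable_on_Sigma_iff using assms(3,4)
    by (auto simp: norm_mult infsum_cmult_right' abs_mult
        intro!: summable_on_cmult_right summable_on_cmult_left)
  hence s: "(\<lambda>p. f (fst p) * g (snd p)) summable_on A \<times> B"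
    by (rule abs_summable_summable)
  have "infsum (\<lambda>p. f (fst p) * g (snd p)) (A \<times> B) = (\<Sum>\<^sub>\<infinity>x\<in>A. \<Sum>\<^sub>\<infinity>y\<in>B. f x * g y)"
    using infsum_Sigma_banach[OF s] by simp
  also have "\<dots> = a * b"
    using assms(1,2) by (simp add: infsum_cmult_right' infsum_cmult_left' infsumI)
  finally show ?thesis
    using has_sum_infsum[OF s] by (simp add: case_prod_unfold)
qed

lemma theta_mult_has_sum:
  assumes "norm w < 1"
  shows "((\<lambda>(m, n). (u powi m * w powi (m\<^sup>2)) * (v powi n * w powi (n\<^sup>2)))
    has_sum (theta u w * theta v w)) (UNIV \<times> UNIV)"
  by (rule has_sum_mult_Times[OF theta_has_sum theta_has_sum theta_abs_summable theta_abs_summable,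
        OF assms assms assms assms])

text \<open>The double series is split by the parity of m + n. For even parity the exponent of w
  becomes 2r^2 + 2s^2. For odd parity it is 2r^2 + 2s^2 + 2r + 2s + 1: the constant, with one spare
  u, gives the factor \<open>u * w\<close>, and the linear part gives the extra
  \<open>w\<^sup>2\<close> in both arguments.\<close>

lemma theta_mult:
  assumes "norm w < 1" and nz: "w \<noteq> 0" "u \<noteq> 0" "v \<noteq> 0"
  shows "theta u w * theta v w =
    theta (u * v) (w\<^sup>2) * theta (u / v) (w\<^sup>2) +
    u * w * (theta (u * v * w\<^sup>2) (w\<^sup>2) * theta (u * w\<^sup>2 / v) (w\<^sup>2))"
proof -
  define F :: "int \<times> int \<Rightarrow> complex"
    where "F = (\<lambda>(m, n). (u powi m * w powi (m\<^sup>2)) * (v powi n * w powi (n\<^sup>2)))"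
  define E O' :: "(int \<times> int) set"
    where "E = {(m, n). even (m + n)}" and "O' = {(m, n). odd (m + n)}"
  have w2: "norm (w\<^sup>2) < 1"
    using assms by (simp add: norm_power power_less_one_iff)
  have sq: "(w\<^sup>2) powi k = w powi (2 * k)" for k
    by (simp add: power_int_mult)
  have "(F has_sum (theta (u * v) (w\<^sup>2) * theta (u / v) (w\<^sup>2))) E"
  proof (subst has_sum_reindex_bij_witness[of "UNIV \<times> UNIV"
        "\<lambda>(m, n). ((m + n) div 2, (m - n) div 2)" "\<lambda>(r, s). (r + s, r - s)" E F, symmetric, OF _ _ _ _ _ refl])
    show "((\<lambda>(r, s). ((u * v) powi r * (w\<^sup>2) powi (r\<^sup>2)) * ((u / v) powi s * (w\<^sup>2) powi (s\<^sup>2)))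
      has_sum (theta (u * v) (w\<^sup>2) * theta (u / v) (w\<^sup>2))) (UNIV \<times> UNIV)"
      by (rule theta_mult_has_sum[OF w2])
  next
    fix a :: "int \<times> int"
    obtain r s where a: "a = (r, s)" by (cases a)
    have "w powi ((r + s)\<^sup>2) * w powi ((r - s)\<^sup>2) = w powi (2 * r\<^sup>2) * w powi (2 * s\<^sup>2)"
      using nz by (simp add: power2_eq_square algebra_simps flip: power_int_add)
    thus "F (case a of (r, s) \<Rightarrow> (r + s, r - s)) = (case a of (r, s) \<Rightarrow>
        ((u * v) powi r * (w\<^sup>2) powi (r\<^sup>2)) * ((u / v) powi s * (w\<^sup>2) powi (s\<^sup>2)))"
      using nz unfolding a F_def sq
      by (simp add: power_int_mult_distrib power_int_divide_distrib
          power_int_add[where m = r] power_int_diff[where m = r])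
  next
    \<comment> \<open>Evenness of m + n makes both halvings exact.\<close>
    fix b assume "b \<in> E"
    thus "(case case b of (m, n) \<Rightarrow> ((m + n) div 2, (m - n) div 2) of (r, s) \<Rightarrow> (r + s, r - s)) = b"
      by (auto simp: E_def) presburger+
  qed (auto simp: E_def)
  moreover have "(F has_sum (u * w * (theta (u * v * w\<^sup>2) (w\<^sup>2) * theta (u * w\<^sup>2 / v) (w\<^sup>2)))) O'"
  proof (subst has_sum_reindex_bij_witness[of "UNIV \<times> UNIV"
        "\<lambda>(m, n). ((m + n - 1) div 2, (m - n - 1) div 2)" "\<lambda>(r, s). (r + s + 1, r - s)" O' F, symmetric, OF _ _ _ _ _ refl])
    show "((\<lambda>p. u * w * (case p of (r, s) \<Rightarrow>
        ((u * v * w\<^sup>2) powi r * (w\<^sup>2) powi (r\<^sup>2)) * ((u * w\<^sup>2 / v) powi s * (w\<^sup>2) powi (s\<^sup>2))))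
      has_sum (u * w * (theta (u * v * w\<^sup>2) (w\<^sup>2) * theta (u * w\<^sup>2 / v) (w\<^sup>2)))) (UNIV \<times> UNIV)"
      by (intro has_sum_cmult_right theta_mult_has_sum[OF w2])
  next
    fix a :: "int \<times> int"
    obtain r s where a: "a = (r, s)" by (cases a)
    have "w powi ((r + s + 1)\<^sup>2) * w powi ((r - s)\<^sup>2)
      = w * (w powi (2 * r) * w powi (2 * r\<^sup>2)) * (w powi (2 * s) * w powi (2 * s\<^sup>2))"
    proof -
      have "(r + s + 1)\<^sup>2 + (r - s)\<^sup>2 = 2 * r + 2 * r\<^sup>2 + 1 + (2 * s + 2 * s\<^sup>2)"
        by (simp add: power2_eq_square algebra_simps)
      thus ?thesis using nz by (simp flip: power_int_add power_int_add_1')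
    qed
    thus "F (case a of (r, s) \<Rightarrow> (r + s + 1, r - s)) = u * w * (case a of (r, s) \<Rightarrow>
        ((u * v * w\<^sup>2) powi r * (w\<^sup>2) powi (r\<^sup>2)) * ((u * w\<^sup>2 / v) powi s * (w\<^sup>2) powi (s\<^sup>2)))"
      using nz unfolding a F_def
      by (simp add: power_int_mult_distrib power_int_divide_distrib sq power_int_add_1
          power_int_add[where m = r] power_int_diff[where m = r])
  next
    fix b assume "b \<in> O'"
    thus "(case case b of (m, n) \<Rightarrow> ((m + n - 1) div 2, (m - n - 1) div 2) of (r, s) \<Rightarrow> (r + s + 1, r - s)) = b"
      by (auto simp: O'_def elim!: oddE)
  qed (auto simp: O'_def)
  ultimately have "(F has_sum (theta (u * v) (w\<^sup>2) * theta (u / v) (w\<^sup>2) +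
    u * w * (theta (u * v * w\<^sup>2) (w\<^sup>2) * theta (u * w\<^sup>2 / v) (w\<^sup>2)))) (E \<union> O')"
    by (rule has_sum_Un_disjoint) (auto simp: E_def O'_def)
  also have "E \<union> O' = UNIV \<times> UNIV" by (auto simp: E_def O'_def)
  finally show ?thesis
    using theta_mult_has_sum[OF assms(1), of u v] unfolding F_def by (rule has_sum_unique[rotated])
qed

text \<open>Even and odd indices are separated, using (2n + 1)^2 = 4n^2 + 4n + 1. Read from right to
  left, it merges two thetas of base \<open>w ^ 4\<close> into one of base \<open>w\<close>.\<close>

lemma theta_split:
  assumes "norm w < 1" and nz: "w \<noteq> 0" "z \<noteq> 0"
  shows "theta z w = theta (z\<^sup>2) (w ^ 4) + z * w * theta (z\<^sup>2 * w ^ 4) (w ^ 4)"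
proof -
  define F :: "int \<Rightarrow> complex" where "F = (\<lambda>n. z powi n * w powi (n\<^sup>2))"
  have w4: "norm (w ^ 4) < 1"
    using assms by (simp add: norm_power power_less_one_iff)
  have sq: "(z\<^sup>2) powi k = z powi (2 * k)" "(w ^ 4) powi k = w powi (4 * k)" for k
    by (simp_all add: power_int_mult)
  have "(F has_sum theta (z\<^sup>2) (w ^ 4)) {n. even n}"
  proof (subst has_sum_reindex_bij_witness[of UNIV "\<lambda>n. n div 2" "\<lambda>n. 2 * n"
        "{n. even n}" F, symmetric, OF _ _ _ _ _ refl])
    show "((\<lambda>n. (z\<^sup>2) powi n * (w ^ 4) powi (n\<^sup>2)) has_sum theta (z\<^sup>2) (w ^ 4)) UNIV"
      by (rule theta_has_sum[OF w4])
  qed (auto simp: F_def sq power_mult_distrib)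
  moreover have "(F has_sum (z * w * theta (z\<^sup>2 * w ^ 4) (w ^ 4))) {n. odd n}"
  proof (subst has_sum_reindex_bij_witness[of UNIV "\<lambda>n. (n - 1) div 2" "\<lambda>n. 2 * n + 1"
        "{n. odd n}" F, symmetric, OF _ _ _ _ _ refl])
    show "((\<lambda>n. z * w * ((z\<^sup>2 * w ^ 4) powi n * (w ^ 4) powi (n\<^sup>2))) has_sum
        (z * w * theta (z\<^sup>2 * w ^ 4) (w ^ 4))) UNIV"
      by (intro has_sum_cmult_right theta_has_sum[OF w4])
  next
    fix n :: int
    have "(2 * n + 1)\<^sup>2 = 1 + (4 * n + 4 * n\<^sup>2)"
      by (simp add: power2_eq_square algebra_simps)
    thus "F (2 * n + 1) = z * w * ((z\<^sup>2 * w ^ 4) powi n * (w ^ 4) powi (n\<^sup>2))"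
      using nz unfolding F_def
      by (simp add: power_int_mult_distrib sq power_int_add)
  qed auto
  ultimately have "(F has_sum (theta (z\<^sup>2) (w ^ 4) + z * w * theta (z\<^sup>2 * w ^ 4) (w ^ 4)))
    ({n. even n} \<union> {n. odd n})"
    by (rule has_sum_Un_disjoint) auto
  also have "{n::int. even n} \<union> {n. odd n} = UNIV" by auto
  finally show ?thesis
    using theta_has_sum[OF assms(1), of z] unfolding F_def by (rule has_sum_unique[rotated])
qed

section \<open>Infinite q-products and the q-binomial theorem\<close>

lemma qpoch_convergent:
  assumes "norm q < 1"
  shows "convergent_prod (\<lambda>n. 1 - a * q ^ n :: complex)"
proof (intro abs_convergent_prod_imp_convergent_prod summable_imp_abs_convergent_prod)
  show "summable (\<lambda>n. norm (1 - a * q ^ n - 1))"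
    using assms by (simp add: norm_mult norm_power summable_mult summable_geometric)
qed

lemma qpoch_inf_LIMSEQ:
  assumes "norm q < 1"
  shows "(\<lambda>n. \<Prod>i<n. 1 - a * q ^ i) \<longlonglongrightarrow> qpoch_inf a q"
  using convergent_prod_LIMSEQ[OF qpoch_convergent[OF assms]]
  unfolding qpoch_inf_def by (subst LIMSEQ_lessThan_iff_atMost)

lemma qpoch_inf_nonzero:
  assumes "norm q < 1" "norm a < 1"
  shows "qpoch_inf a q \<noteq> 0"
  unfolding qpoch_inf_def
proof (rule prodinf_nonzero[OF qpoch_convergent[OF assms(1)]])
  fix i
  have "norm (a * q ^ i) \<le> norm a * 1"
    unfolding norm_mult norm_power using assms by (intro mult_left_mono power_le_one) auto
  also have "\<dots> < 1" using assms by simp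
  finally show "1 - a * q ^ i \<noteq> 0" by auto
qed

text \<open>This is (q; q)_n, the q-factorial without division by powers of 1 - q.\<close>

definition qfact :: "complex \<Rightarrow> nat \<Rightarrow> complex" where
  "qfact q n = (\<Prod>i<n. 1 - q ^ Suc i)"

text \<open>The value 0 for k > n lets the Pascal rule hold at k = n and lets sums run one index too
  far.\<close>

definition gauss_binomial :: "complex \<Rightarrow> nat \<Rightarrow> nat \<Rightarrow> complex" where
  "gauss_binomial q n k = (if k \<le> n then qfact q n / (qfact q k * qfact q (n - k)) else 0)"

lemma qfact_Suc: "qfact q (Suc n) = qfact q n * (1 - q ^ Suc n)"
  by (simp add: qfact_def)

lemma qfact_nonzero:
  assumes "norm q < 1"
  shows "qfact q n \<noteq> 0"
proof -
  have "q ^ Suc i \<noteq> 1" for i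
    using assms power_less_one_iff[of "norm q" "Suc i"] by (metis less_irrefl nat.distinct(1) norm_ge_zero norm_one norm_power not_gr_zero)
  thus ?thesis by (auto simp: qfact_def)
qed

lemma gauss_binomial_0: "norm q < 1 \<Longrightarrow> gauss_binomial q n 0 = 1"
  by (simp add: gauss_binomial_def qfact_nonzero) (simp add: qfact_def)

text \<open>Over a common denominator this is 1 - q^(n+1) = (1 - q^(n-k)) + q^(n-k) (1 - q^(k+1)).
  This form of the q-Pascal rule is chosen because its weight q^(n-k) meets a q^k in the q-binomial
  theorem and yields q^n, independent of k.\<close>

lemma gauss_binomial_Suc_Suc:
  assumes "norm q < 1" "k \<le> n"
  shows "gauss_binomial q (Suc n) (Suc k) =
    gauss_binomial q n (Suc k) + q ^ (n - k) * gauss_binomial q n k"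
proof (cases "k = n")
  case True
  thus ?thesis using qfact_nonzero[OF assms(1)] by (simp add: gauss_binomial_def)
next
  case False
  then obtain m where n: "n = k + Suc m"
    using assms(2) by (metis add_Suc_right less_imp_Suc_add nat_less_le)
  have nz: "qfact q i \<noteq> 0" "1 - q ^ Suc i \<noteq> 0" for i
    using qfact_nonzero[OF assms(1)] qfact_nonzero[OF assms(1), of "Suc i"]
    by (auto simp: qfact_Suc simp del: power_Suc)
  have "1 - q ^ Suc n = (1 - q ^ Suc m) + q ^ Suc m * (1 - q ^ Suc k)"
    by (simp add: n algebra_simps flip: power_add)
  moreover have "gauss_binomial q (Suc n) (Suc k) =
      qfact q n * (1 - q ^ Suc n) / (qfact q (Suc k) * qfact q (Suc m))"
    by (simp add: gauss_binomial_def n qfact_Suc)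
  moreover have "gauss_binomial q n (Suc k) =
      qfact q n * (1 - q ^ Suc m) / (qfact q (Suc k) * qfact q (Suc m))"
    using nz[of m] by (simp add: gauss_binomial_def n qfact_Suc[of q m] del: power_Suc)
  moreover have "gauss_binomial q n k =
      qfact q n * (1 - q ^ Suc k) / (qfact q (Suc k) * qfact q (Suc m))"
    using nz[of k] by (simp add: gauss_binomial_def n qfact_Suc[of q k] del: power_Suc)
  moreover have "n - k = Suc m" by (simp add: n)
  ultimately show ?thesis
    by (simp only: add_divide_distrib[symmetric] times_divide_eq_right)
       (simp only: algebra_simps)
qed

lemma q_binomial_theorem:
  assumes "norm q < 1"
  shows "(\<Prod>i<n. 1 + x * q ^ i) = (\<Sum>k\<le>n. gauss_binomial q n k * (q ^ (k choose 2) * x ^ k))"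
proof (induction n)
  case 0
  thus ?case using assms by (simp add: gauss_binomial_0 numeral_2_eq_2)
next
  case (Suc n)
  define t where "t = (\<lambda>k. q ^ (k choose 2) * x ^ k)"
  have t: "t (Suc k) = t k * q ^ k * x" for k
    by (simp add: t_def numeral_2_eq_2 power_add algebra_simps)
  let ?g = "gauss_binomial q"
  have "(\<Sum>k\<le>Suc n. ?g (Suc n) k * t k) = t 0 + (\<Sum>k\<le>n. ?g (Suc n) (Suc k) * t (Suc k))"
    using assms by (subst sum.atMost_Suc_shift) (simp add: gauss_binomial_0)
  \<comment> \<open>The Pascal rule separates the old sum from \<open>x * q ^ n\<close> times the
    old sum, which is multiplication by the new factor.\<close>
  also have "(\<Sum>k\<le>n. ?g (Suc n) (Suc k) * t (Suc k)) =
      (\<Sum>k\<le>n. ?g n (Suc k) * t (Suc k) + x * q ^ n * (?g n k * t k))"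
  proof (rule sum.cong)
    fix k assume "k \<in> {..n}"
    hence "q ^ n = q ^ (n - k) * q ^ k" by (simp flip: power_add)
    thus "?g (Suc n) (Suc k) * t (Suc k) = ?g n (Suc k) * t (Suc k) + x * q ^ n * (?g n k * t k)"
      using gauss_binomial_Suc_Suc[OF assms, of k n] \<open>k \<in> {..n}\<close>
      by (simp add: t algebra_simps)
  qed auto
  also have "t 0 + \<dots> = (t 0 + (\<Sum>k\<le>n. ?g n (Suc k) * t (Suc k))) + x * q ^ n * (\<Sum>k\<le>n. ?g n k * t k)"
    by (simp add: sum.distrib sum_distrib_left)
  also have "t 0 + (\<Sum>k\<le>n. ?g n (Suc k) * t (Suc k)) = (\<Sum>k\<le>Suc n. ?g n k * t k)"
    using assms by (subst sum.atMost_Suc_shift) (simp add: gauss_binomial_0)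
  also have "\<dots> = (\<Sum>k\<le>n. ?g n k * t k)"
    by (simp add: gauss_binomial_def)
  finally show ?case
    using Suc.IH by (simp add: t_def algebra_simps)
qed

section \<open>The Jacobi triple product, first in finite form and then in the limit\<close>

lemma finite_triple_product:
  assumes "norm w < 1" "w \<noteq> 0" "z \<noteq> 0"
  shows "(\<Prod>i<n. 1 + z * w ^ (2 * i + 1)) * (\<Prod>i<n. 1 + w ^ (2 * i + 1) / z) =
    (\<Sum>j=- int n..int n. gauss_binomial (w\<^sup>2) (2 * n) (nat (int n + j)) * (z powi j * w powi j\<^sup>2))"
proof -
  \<comment> \<open>With this \<open>x\<close>, the 2n factors of the q-binomial theorem in base
    \<open>w\<^sup>2\<close> carry the odd powers of w from 1 - 2n to 2n - 1, each times z. The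
    upper n factors are those of the first product.\<close>
  define x where "x = z * w powi (1 - 2 * int n)"
  \<comment> \<open>The reciprocal of what is pulled out of the lower n factors to turn each
    \<open>1 + z / w ^ (2 * i + 1)\<close> into \<open>1 + w ^ (2 * i + 1) / z\<close>.\<close>
  define c where "c = z powi - int n * w powi (int n)\<^sup>2"
  have w2: "norm (w\<^sup>2) < 1"
    using assms by (simp add: norm_power power_less_one_iff)
  have factor: "x * (w\<^sup>2) ^ i = z * w powi (1 - 2 * int n + 2 * int i)" for i
    using assms unfolding x_def
    by (simp add: power_int_add power_int_mult)
  have concat: "prod f {..<n + m} = prod f {..<n} * (\<Prod>i<m. f (n + i))" for f :: "nat \<Rightarrow> complex" and m
    by (induction m) auto
  have "(\<Prod>i<n. 1 + x * (w\<^sup>2) ^ (n + i)) = (\<Prod>i<n. 1 + z * w ^ (2 * i + 1))"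
  proof (rule prod.cong)
    fix i
    have "w powi (1 - 2 * int n + 2 * int (n + i)) = w powi int (2 * i + 1)"
      by (simp add: algebra_simps)
    thus "1 + x * (w\<^sup>2) ^ (n + i) = 1 + z * w ^ (2 * i + 1)"
      unfolding factor by (simp only: power_int_of_nat)
  qed simp
  moreover have "c * (\<Prod>i<n. 1 + x * (w\<^sup>2) ^ i) = (\<Prod>i<n. 1 + w ^ (2 * i + 1) / z)"
  proof -
    \<comment> \<open>Reversing the order makes the negative exponents run through -1, -3, and so
      on.\<close>
    have "(\<Prod>i<n. 1 + x * (w\<^sup>2) ^ i) = (\<Prod>i<n. 1 + x * (w\<^sup>2) ^ (n - Suc i))"
      by (rule prod.nat_diff_reindex[symmetric])
    also have "\<dots> = (\<Prod>i<n. z / w ^ (2 * i + 1) * (1 + w ^ (2 * i + 1) / z))"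
    proof (rule prod.cong)
      fix i assume i: "i \<in> {..<n}"
      hence "1 - 2 * int n + 2 * int (n - Suc i) = - int (2 * i + 1)"
        by (simp add: of_nat_diff)
      hence "x * (w\<^sup>2) ^ (n - Suc i) = z / w ^ (2 * i + 1)"
        unfolding factor by (simp only: power_int_minus power_int_of_nat divide_inverse)
      thus "1 + x * (w\<^sup>2) ^ (n - Suc i) = z / w ^ (2 * i + 1) * (1 + w ^ (2 * i + 1) / z)"
        using assms by (simp add: field_simps)
    qed simp
    also have "\<dots> = (\<Prod>i<n. z / w ^ (2 * i + 1)) * (\<Prod>i<n. 1 + w ^ (2 * i + 1) / z)"
      by (rule prod.distrib)
    also have "(\<Prod>i<n. z / w ^ (2 * i + 1)) = z ^ n / w ^ (n\<^sup>2)"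
    proof (induction n)
      case (Suc n)
      have "(Suc n)\<^sup>2 = n\<^sup>2 + (2 * n + 1)" by (simp add: power2_eq_square)
      thus ?case using Suc by (simp add: power_add mult_ac)
    qed simp
    also have "\<dots> = inverse c"
      by (simp add: c_def power_int_minus divide_inverse flip: power_int_of_nat)
    finally have "(\<Prod>i<n. 1 + x * (w\<^sup>2) ^ i) = inverse c * (\<Prod>i<n. 1 + w ^ (2 * i + 1) / z)" .
    moreover have "c \<noteq> 0" using assms by (simp add: c_def)
    ultimately show ?thesis by simp
  qed
  ultimately have "(\<Prod>i<n. 1 + z * w ^ (2 * i + 1)) * (\<Prod>i<n. 1 + w ^ (2 * i + 1) / z) =
      c * (\<Prod>i<2 * n. 1 + x * (w\<^sup>2) ^ i)"
    using concat[of "\<lambda>i. 1 + x * (w\<^sup>2) ^ i" n] by (simp add: mult_2)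
  also have "\<dots> = (\<Sum>k\<le>2 * n. gauss_binomial (w\<^sup>2) (2 * n) k * (c * ((w\<^sup>2) ^ (k choose 2) * x ^ k)))"
    unfolding q_binomial_theorem[OF w2] by (simp add: sum_distrib_left mult_ac)
  also have "\<dots> = (\<Sum>j=- int n..int n. gauss_binomial (w\<^sup>2) (2 * n) (nat (int n + j)) * (z powi j * w powi j\<^sup>2))"
  \<comment> \<open>With j = k - n, the total exponent of w completes to the square (k -
    n)^2.\<close>
  proof (rule sum.reindex_bij_witness[of _ "\<lambda>j. nat (int n + j)" "\<lambda>k. int k - int n"])
    fix k
    have "2 * int (k choose 2) = int k * (int k - 1)"
      by (induction k) (auto simp: numeral_2_eq_2 algebra_simps)
    hence "(int n)\<^sup>2 + 2 * int (k choose 2) + (1 - 2 * int n) * int k = (int k - int n)\<^sup>2"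
      by (simp add: power2_eq_square algebra_simps)
    moreover have "c * ((w\<^sup>2) ^ (k choose 2) * x ^ k) =
      z powi (int k - int n) * w powi ((int n)\<^sup>2 + 2 * int (k choose 2) + (1 - 2 * int n) * int k)"
    proof -
      have "(w\<^sup>2) ^ (k choose 2) = w powi (2 * int (k choose 2))"
        by (simp add: power_int_mult)
      moreover have "x ^ k = z ^ k * w powi ((1 - 2 * int n) * int k)"
        by (simp add: x_def power_mult_distrib power_int_mult)
      moreover have "z powi (int k - int n) = z powi - int n * z ^ k"
        using assms by (simp add: power_int_diff power_int_minus field_simps)
      ultimately show ?thesis using assms by (simp add: c_def power_int_add)
    qed
    ultimately show "gauss_binomial (w\<^sup>2) (2 * n) (nat (int n + (int k - int n))) *
        (z powi (int k - int n) * w powi (int k - int n)\<^sup>2) =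
      gauss_binomial (w\<^sup>2) (2 * n) k * (c * ((w\<^sup>2) ^ (k choose 2) * x ^ k))"
      by simp
  qed auto
  finally show ?thesis .
qed

lemma qfact_LIMSEQ:
  assumes "norm q < 1"
  shows "qfact q \<longlonglongrightarrow> qpoch_inf q q"
  using qpoch_inf_LIMSEQ[OF assms, of q] by (simp add: qfact_def[abs_def])

text \<open>The sequence (q; q)_n converges to a nonzero limit, so it and its reciprocals are
  bounded. Uniformity in n and k supplies the dominating constant for Tannery's theorem.\<close>

lemma gauss_binomial_bounded:
  assumes "norm q < 1"
  obtains C where "\<And>n k. norm (gauss_binomial q n k) \<le> C"
proof -
  have "Bseq (qfact q)" "Bseq (\<lambda>n. inverse (qfact q n))"
    using qfact_LIMSEQ[OF assms] qpoch_inf_nonzero[OF assms assms]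
    by (auto intro!: convergent_imp_Bseq convergentI tendsto_inverse)
  then obtain K L where K: "K > 0" "\<And>n. norm (qfact q n) \<le> K"
    and L: "L > 0" "\<And>n. norm (inverse (qfact q n)) \<le> L"
    by (auto simp: Bseq_def)
  have "norm (gauss_binomial q n k) \<le> K * (L * L)" for n k
  proof (cases "k \<le> n")
    case True
    hence "norm (gauss_binomial q n k) =
        norm (qfact q n) * (norm (inverse (qfact q k)) * norm (inverse (qfact q (n - k))))"
      by (simp add: gauss_binomial_def norm_mult norm_divide norm_inverse divide_inverse)
    also have "\<dots> \<le> K * (L * L)"
      using K L by (intro mult_mono mult_nonneg_nonneg) (auto simp: less_imp_le)
    finally show ?thesis .
  qed (use K L in \<open>auto simp: gauss_binomial_def\<close>)
  thus ?thesis by (rule that)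
qed

text \<open>All three q-factorials in the quotient tend to P = (q; q)_inf, which leaves P /
  P^2.\<close>

lemma gauss_binomial_central_LIMSEQ:
  assumes "norm q < 1"
  shows "(\<lambda>n. gauss_binomial q (2 * n) (nat (int n + j))) \<longlonglongrightarrow> 1 / qpoch_inf q q"
proof -
  let ?P = "qpoch_inf q q"
  have P: "?P \<noteq> 0" by (rule qpoch_inf_nonzero[OF assms assms])
  have shift: "filterlim (\<lambda>n. nat (int n + i)) sequentially sequentially" for i
    unfolding filterlim_at_top
  proof
    fix Z
    show "\<forall>\<^sub>F n in sequentially. Z \<le> nat (int n + i)"
      using eventually_ge_at_top[of "Z + nat (- i)"] by eventually_elim auto
  qed
  have "filterlim (\<lambda>n::nat. 2 * n) sequentially sequentially"
    by (rule filterlim_subseq) (auto simp: strict_mono_def)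
  note lims = filterlim_compose[OF qfact_LIMSEQ[OF assms] this]
    filterlim_compose[OF qfact_LIMSEQ[OF assms] shift]
  have "(\<lambda>n. qfact q (2 * n) / (qfact q (nat (int n + j)) * qfact q (nat (int n + - j)))) \<longlonglongrightarrow>
    ?P / (?P * ?P)"
    using P by (intro tendsto_divide tendsto_mult lims) auto
  also have "?P / (?P * ?P) = 1 / ?P" using P by simp
  finally show ?thesis
  proof (rule Lim_transform_eventually)
    show "\<forall>\<^sub>F n in sequentially. qfact q (2 * n) / (qfact q (nat (int n + j)) * qfact q (nat (int n + - j)))
      = gauss_binomial q (2 * n) (nat (int n + j))"
      \<comment> \<open>From here on n + j and n - j are nonnegative, so \<open>nat\<close>
        truncates nothing.\<close>
      using eventually_ge_at_top[of "nat \<bar>j\<bar>"]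
    proof eventually_elim
      case (elim n)
      hence "nat (int n + j) \<le> 2 * n" "2 * n - nat (int n + j) = nat (int n + - j)" by auto
      thus ?case by (simp add: gauss_binomial_def)
    qed
  qed
qed

text \<open>Let n tend to infinity in the finite identity; Tannery's theorem moves the limit inside
  the sum, dominated by a constant times the absolute theta terms.\<close>

theorem jacobi_triple_product:
  assumes "norm w < 1" "w \<noteq> 0" "z \<noteq> 0"
  shows "theta z w =
    qpoch_inf (- (z * w)) (w\<^sup>2) * qpoch_inf (- (w / z)) (w\<^sup>2) * qpoch_inf (w\<^sup>2) (w\<^sup>2)"
proof -
  define t where "t = (\<lambda>j::int. z powi j * w powi j\<^sup>2)"
  define g where "g = (\<lambda>n j. gauss_binomial (w\<^sup>2) (2 * n) (nat (int n + j)))"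
  let ?P = "qpoch_inf (w\<^sup>2) (w\<^sup>2)"
  have w2: "norm (w\<^sup>2) < 1"
    using assms by (simp add: norm_power power_less_one_iff)
  obtain C where C: "norm (g n j) \<le> C" for n j
    unfolding g_def using gauss_binomial_bounded[OF w2] by metis
  have C0: "C \<ge> 0" using C[of 0 0] norm_ge_zero order_trans by blast
  have t_abs: "summable (\<lambda>k. norm (t (int_decode k)))"
  proof -
    have "(\<lambda>k. norm (t (int_decode k))) summable_on UNIV"
      using theta_abs_summable[OF assms(1), of z] bij_int_decode
      unfolding t_def by (subst summable_on_reindex_bij_betw)
    thus ?thesis by (rule summable_on_imp_summable)
  qed
  have t_sums: "(\<lambda>k. t (int_decode k)) sums theta z w"
    using theta_has_sum[OF assms(1), of z] bij_int_decode
    unfolding t_def by (intro has_sum_imp_sums) (subst has_sum_reindex_bij_betw)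
  \<comment> \<open>\<open>int_decode\<close> lists the integers as a sequence, and the cutoff
    extends the finite sum over -n..n by zeros, giving series over the naturals.\<close>
  define a where "a = (\<lambda>k n. if \<bar>int_decode k\<bar> \<le> int n then g n (int_decode k) * t (int_decode k) else 0)"
  have "(\<lambda>n. \<Sum>k. a k n) \<longlonglongrightarrow> (\<Sum>k. 1 / ?P * t (int_decode k))"
  proof (rule tannerys_theorem[THEN conjunct2, THEN conjunct2])
    fix k
    have "(\<lambda>n. g n (int_decode k) * t (int_decode k)) \<longlonglongrightarrow> 1 / ?P * t (int_decode k)"
      unfolding g_def by (intro tendsto_mult gauss_binomial_central_LIMSEQ w2 tendsto_const)
    thus "a k \<longlonglongrightarrow> 1 / ?P * t (int_decode k)"
    proof (rule Lim_transform_eventually)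
      show "\<forall>\<^sub>F n in sequentially. g n (int_decode k) * t (int_decode k) = a k n"
        using eventually_ge_at_top[of "nat \<bar>int_decode k\<bar>"]
        by eventually_elim (auto simp: a_def)
    qed
  next
    show "\<forall>\<^sub>F (k, n) in sequentially \<times>\<^sub>F sequentially. norm (a k n) \<le> C * norm (t (int_decode k))"
      using C C0 by (intro always_eventually) (auto simp: a_def norm_mult intro: mult_right_mono)
  next
    show "summable (\<lambda>k. C * norm (t (int_decode k)))"
      by (intro summable_mult t_abs)
  qed auto
  also have "(\<Sum>k. 1 / ?P * t (int_decode k)) = 1 / ?P * theta z w"
    by (intro sums_unique[symmetric] sums_mult t_sums)
  also have "(\<lambda>n. \<Sum>k. a k n) =
    (\<lambda>n. (\<Prod>i<n. 1 - (- (z * w)) * (w\<^sup>2) ^ i) * (\<Prod>i<n. 1 - (- (w / z)) * (w\<^sup>2) ^ i))"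
  proof
    fix n
    define h where "h = (\<lambda>j. if \<bar>j\<bar> \<le> int n then g n j * t j else 0)"
    have "(h has_sum (\<Sum>j=- int n..int n. g n j * t j)) UNIV"
      by (rule has_sum_finite_neutralI[of "{- int n..int n}"]) (auto simp: h_def intro!: sum.cong)
    hence "((\<lambda>k. h (int_decode k)) has_sum (\<Sum>j=- int n..int n. g n j * t j)) UNIV"
      using bij_int_decode by (subst has_sum_reindex_bij_betw)
    hence "(\<Sum>k. a k n) = (\<Sum>j=- int n..int n. g n j * t j)"
      unfolding a_def h_def by (intro sums_unique[symmetric] has_sum_imp_sums)
    also have "\<dots> = (\<Prod>i<n. 1 + z * w ^ (2 * i + 1)) * (\<Prod>i<n. 1 + w ^ (2 * i + 1) / z)"
      unfolding finite_triple_product[OF assms] g_def t_def ..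
    also have "\<dots> = (\<Prod>i<n. 1 - (- (z * w)) * (w\<^sup>2) ^ i) * (\<Prod>i<n. 1 - (- (w / z)) * (w\<^sup>2) ^ i)"
      by (simp add: mult_ac flip: power_mult)
    finally show "(\<Sum>k. a k n) = \<dots>" .
  qed
  finally have "1 / ?P * theta z w = qpoch_inf (- (z * w)) (w\<^sup>2) * qpoch_inf (- (w / z)) (w\<^sup>2)"
    by (rule LIMSEQ_unique) (intro tendsto_mult qpoch_inf_LIMSEQ w2)
  thus ?thesis
    using qpoch_inf_nonzero[OF w2 w2] by (simp add: field_simps)
qed

text \<open>Take w to be a square root of ab and z = a / w; then zw = a and w / z = b.\<close>

corollary ramanujan_f_product:
  assumes "a \<noteq> 0" "b \<noteq> 0" "norm (a * b) < 1"
  shows "ramanujan_f a b =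
    qpoch_inf (- a) (a * b) * qpoch_inf (- b) (a * b) * qpoch_inf (a * b) (a * b)"
proof -
  define w where "w = csqrt (a * b)"
  have w2: "w\<^sup>2 = a * b" and "w \<noteq> 0"
    using assms by (auto simp: w_def)
  hence ww: "w * w = a * b" by (simp add: power2_eq_square)
  have "norm (w\<^sup>2) < 1" using assms(3) by (simp add: w2)
  hence "norm w < 1"
    by (simp add: norm_power power_less_one_iff)
  moreover have "a / w * w = a" "w / (a / w) = b"
    using assms \<open>w \<noteq> 0\<close> by (simp_all add: ww)
  ultimately show ?thesis
    using jacobi_triple_product[of w "a / w"] ramanujan_f_eq_theta[of "a / w" w] assms \<open>w \<noteq> 0\<close>
    by (simp add: w2)
qed

section \<open>The three theta identities behind the theorem\<close>

text \<open>In \<open>theta_mult\<close> take u = -z/p and v = 1: then uv = u/v, so both summands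
  are squares, and the factor \<open>u * w\<close> is -z.\<close>

lemma theta_diff_squares:
  assumes "norm p < 1" "p \<noteq> 0" "z \<noteq> 0"
  shows "(theta (- (z / p)) (p\<^sup>2))\<^sup>2 - z * (theta (- (p * z)) (p\<^sup>2))\<^sup>2 = theta (- (z / p)) p * theta 1 p"
proof -
  have "- (z / p) * p\<^sup>2 = - (p * z)" using assms by (simp add: power2_eq_square mult.commute)
  thus ?thesis
    using theta_mult[OF assms(1,2), of "- (z / p)" 1] assms by (simp add: power2_eq_square mult.commute)
qed

text \<open>Here u = z/p and v = -1: again uv = u/v = -z/p, while the factor \<open>u * w\<close> is
  now +z.\<close>

lemma theta_sum_squares:
  assumes "norm p < 1" "p \<noteq> 0" "z \<noteq> 0"
  shows "(theta (- (z / p)) (p\<^sup>2))\<^sup>2 + z * (theta (- (p * z)) (p\<^sup>2))\<^sup>2 = theta (z / p) p * theta (- 1) p"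
proof -
  have "z / p * p\<^sup>2 = p * z" using assms by (simp add: power2_eq_square mult.commute)
  thus ?thesis
    using theta_mult[OF assms(1,2), of "z / p" "- 1"] assms by (simp add: power2_eq_square mult.commute)
qed

text \<open>In base \<open>p\<^sup>2\<close> the ratio of the arguments is p^(-2), and its shift by
  p^4 is p^2. Inversion symmetry makes these two thetas equal, so they factor out; what remains is
  the even-odd dissection of \<open>theta (- z) p\<close>.\<close>

lemma theta_mult_shifted:
  assumes "norm p < 1" "p \<noteq> 0" "z \<noteq> 0"
  shows "theta (- (z / p)) (p\<^sup>2) * theta (- (p * z)) (p\<^sup>2) = theta (inverse (p\<^sup>2)) (p ^ 4) * theta (- z) p"
proof -
  have p2: "norm (p\<^sup>2) < 1" using assms by (simp add: norm_power power_less_one_iff)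
  have args: "(- (z / p)) * (- (p * z)) = z\<^sup>2" "(- (z / p)) / (- (p * z)) = inverse (p\<^sup>2)"
    "- (z / p) * p\<^sup>2 = - z * p" "- (z / p) * p ^ 4 / (- (p * z)) = p\<^sup>2"
    "(p\<^sup>2)\<^sup>2 = p ^ 4"
    using assms by (simp_all add: field_simps power2_eq_square power4_eq_xxxx)
  have "theta (- (z / p)) (p\<^sup>2) * theta (- (p * z)) (p\<^sup>2) =
    theta (z\<^sup>2) (p ^ 4) * theta (inverse (p\<^sup>2)) (p ^ 4) +
    - z * p * (theta (z\<^sup>2 * p ^ 4) (p ^ 4) * theta (p\<^sup>2) (p ^ 4))"
    using theta_mult[OF p2, of "- (z / p)" "- (p * z)"] assms unfolding args by simp
  also have "\<dots> = theta (inverse (p\<^sup>2)) (p ^ 4) *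
    (theta ((- z)\<^sup>2) (p ^ 4) + - z * p * theta ((- z)\<^sup>2 * p ^ 4) (p ^ 4))"
    by (simp add: theta_inverse algebra_simps)
  also have "theta ((- z)\<^sup>2) (p ^ 4) + - z * p * theta ((- z)\<^sup>2 * p ^ 4) (p ^ 4) = theta (- z) p"
    using theta_split[OF assms(1,2), of "- z"] assms by simp
  finally show ?thesis .
qed

section \<open>The identities for \<open>Y k q\<close>\<close>

theorem theorem2p2:
  fixes q :: complex and k :: nat
  assumes "norm q < 1" and "k \<in> {1..8}"
  shows "Y k q = q ^ k *
           (ramanujan_f (- (q ^ (17 - 2 * k))) (- (q ^ (51 + 2 * k))) /
            ramanujan_f (- (q ^ (17 + 2 * k))) (- (q ^ (51 - 2 * k)))) \<and>
         1 / Y k q + Y k q =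
           ramanujan_phi (- (q ^ 17)) * ramanujan_f (q ^ (2 * k)) (q ^ (34 - 2 * k)) /
           (q ^ k * ramanujan_psi (q ^ 34) *
            ramanujan_f (- (q ^ (17 - 2 * k))) (- (q ^ (17 + 2 * k)))) \<and>
         1 / Y k q - Y k q =
           ramanujan_phi (q ^ 17) * ramanujan_f (- (q ^ (2 * k))) (- (q ^ (34 - 2 * k))) /
           (q ^ k * ramanujan_psi (q ^ 34) *
            ramanujan_f (- (q ^ (17 - 2 * k))) (- (q ^ (17 + 2 * k))))"
proof (cases "q = 0")
  case True
  \<comment> \<open>Since k >= 1, \<open>q ^ k\<close> is 0, and with division by zero equal to 0
    every side vanishes.\<close>
  thus ?thesis using assms(2) by (simp add: Y_def power_0_left)
next
  case q0: False
  have k: "k \<ge> 1" "k \<le> 8" using assms(2) by auto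
  define p z where "p = q ^ 17" and "z = q ^ (2 * k)"
  have nz: "p \<noteq> 0" "z \<noteq> 0" using q0 by (simp_all add: p_def z_def)
  have less1: "norm (q ^ m) < 1" if "m > 0" for m
    using assms(1) that by (simp add: norm_power power_less_one_iff)
  have p1: "norm p < 1" unfolding p_def by (rule less1) simp
  \<comment> \<open>The bound k <= 8 keeps all these natural subtractions exact.\<close>
  have args: "q ^ (17 - 2 * k) = p / z" "q ^ (51 + 2 * k) = p ^ 3 * z" "q ^ (17 + 2 * k) = p * z"
    "q ^ (51 - 2 * k) = p ^ 3 / z" "q ^ (34 - 2 * k) = p\<^sup>2 / z" "q ^ 34 = p\<^sup>2"
    using q0 k by (simp_all add: p_def z_def power_diff power_add flip: power_mult)
  define A B where "A = theta (- (p * z)) (p\<^sup>2)" and "B = theta (- (z / p)) (p\<^sup>2)"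
  define P where "P = qpoch_inf (q ^ 68) (q ^ 68)"

  \<comment> \<open>Exponents adding to 68 give the common base q^68 and the common factor
    \<open>P\<close>, which cancels in the quotient; positive exponents keep every factor
    nonzero.\<close>
  have f_prod: "ramanujan_f (- (q ^ i)) (- (q ^ j)) = qpochs_inf [q ^ i, q ^ j] (q ^ 68) * P"
    and f_nonzero: "ramanujan_f (- (q ^ i)) (- (q ^ j)) \<noteq> 0"
    if "i + j = 68" "i > 0" "j > 0" for i j
  proof -
    have *: "- (q ^ i) * - (q ^ j) = q ^ 68"
      using that by (simp flip: power_add)
    show f: "ramanujan_f (- (q ^ i)) (- (q ^ j)) = qpochs_inf [q ^ i, q ^ j] (q ^ 68) * P"
      using ramanujan_f_product[of "- (q ^ i)" "- (q ^ j)"] q0 less1[of 68] unfolding *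
      by (simp add: qpochs_inf_def P_def)
    show "ramanujan_f (- (q ^ i)) (- (q ^ j)) \<noteq> 0"
      unfolding f P_def qpochs_inf_def using that by (auto simp: qpoch_inf_nonzero less1)
  qed
  have P: "P \<noteq> 0" unfolding P_def by (intro qpoch_inf_nonzero less1) auto

  \<comment> \<open>The product form first gives the argument -1/(pz); inversion symmetry replaces
    it by -pz.\<close>
  have A: "ramanujan_f (- (q ^ (17 - 2 * k))) (- (q ^ (51 + 2 * k))) = A"
    using ramanujan_f_eq_theta[of "- inverse (p * z)" "p\<^sup>2"] nz theta_inverse[of "- (p * z)" "p\<^sup>2"]
    unfolding args A_def by (simp add: field_simps power2_eq_square power3_eq_cube)
  have B: "ramanujan_f (- (q ^ (17 + 2 * k))) (- (q ^ (51 - 2 * k))) = B"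
    using ramanujan_f_eq_theta[of "- (z / p)" "p\<^sup>2"] nz
    unfolding args B_def by (simp add: field_simps power2_eq_square power3_eq_cube)
  have AB: "A \<noteq> 0" "B \<noteq> 0"
    unfolding A [symmetric] B [symmetric]
    using k f_nonzero[of "17 - 2 * k" "51 + 2 * k"] f_nonzero[of "17 + 2 * k" "51 - 2 * k"] by auto
  have Y: "Y k q = q ^ k * (A / B)"
    unfolding A [symmetric] B [symmetric] using k P by (simp add: Y_def f_prod)

  have phi: "ramanujan_phi p = theta 1 p" "ramanujan_phi (- p) = theta (- 1) p"
    using ramanujan_f_eq_theta[of 1 p] ramanujan_f_eq_theta[of "- 1" p] nz
    by (simp_all add: ramanujan_phi_def)
  have f: "ramanujan_f z (p\<^sup>2 / z) = theta (z / p) p" "ramanujan_f (- z) (- (p\<^sup>2 / z)) = theta (- (z / p)) p"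
    using ramanujan_f_eq_theta[of "z / p" p] ramanujan_f_eq_theta[of "- (z / p)" p] nz
    by (simp_all add: power2_eq_square)
  \<comment> \<open>Indeed psi(p^2) = f(p^2, p^6), whose parameters are z = p^(-2) and w =
    p^4.\<close>
  have "ramanujan_psi (p\<^sup>2) = theta (inverse (p\<^sup>2)) (p ^ 4)"
    using ramanujan_f_eq_theta[of "inverse (p\<^sup>2)" "p ^ 4"] nz
    by (simp add: ramanujan_psi_def field_simps eval_nat_numeral)
  moreover have "ramanujan_f (- (p / z)) (- (p * z)) = theta (- z) p"
    using ramanujan_f_eq_theta[of "- inverse z" p] theta_inverse[of "- z" p] nz
    by (simp add: field_simps)
  ultimately have denom: "ramanujan_psi (p\<^sup>2) * ramanujan_f (- (p / z)) (- (p * z)) = A * B"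
    using theta_mult_shifted[OF p1 nz] by (simp add: A_def B_def mult_ac)

  have z: "z = q ^ k * q ^ k" by (simp add: z_def mult_2 power_add)
  \<comment> \<open>Putting B / (q^k A) and q^k A / B over a common denominator produces q^(2k) = z
    in front of A^2.\<close>
  have "1 / Y k q + Y k q = (B\<^sup>2 + z * A\<^sup>2) / (q ^ k * (A * B))"
    "1 / Y k q - Y k q = (B\<^sup>2 - z * A\<^sup>2) / (q ^ k * (A * B))"
    using AB q0 unfolding Y z by (simp_all add: field_simps power2_eq_square)
  hence "1 / Y k q + Y k q = ramanujan_phi (- p) * ramanujan_f z (p\<^sup>2 / z) /
      (q ^ k * ramanujan_psi (p\<^sup>2) * ramanujan_f (- (p / z)) (- (p * z)))"
    "1 / Y k q - Y k q = ramanujan_phi p * ramanujan_f (- z) (- (p\<^sup>2 / z)) /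
      (q ^ k * ramanujan_psi (p\<^sup>2) * ramanujan_f (- (p / z)) (- (p * z)))"
    unfolding mult.assoc denom phi f
    using theta_sum_squares[OF p1 nz] theta_diff_squares[OF p1 nz]
    by (simp_all add: A_def B_def mult.commute)
  with Y show ?thesis
    unfolding A B unfolding args p_def [symmetric] z_def [symmetric] by blast
qed

end
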